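(* Let $\alpha$ be a real number not in $\mathbb{Q}(\mathbf{H}_4)$ and let $\{p_i/q_i\}_{i\ge1}$ be the sequence of all $\mathbf{H}_4$-best approximations of $\alpha$, ordered so that $q_i<q_{i+1}$. Then $$K(\alpha)=\limsup_{i\to\infty}q_i\,|q_{i-1}\alpha-p_{i-1}|.$$
   Context: The Hecke group $\mathbf{H}_4$ is the subgroup of $\mathrm{PSL}_2(\mathbb{R})$ generated by $\begin{pmatrix}1&\sqrt2\\0&1\end{pmatrix}$ and $\begin{pmatrix}0&-1\\1&0\end{pmatrix}$. The set $\mathbb{Q}(\mathbf{H}_4)\subset \mathbb{R}\cup\{\infty\}$ is the set of all $p/q$ such that $\begin{pmatrix} p & r \\ q & s \end{pmatrix}\in\mathbf{H}_4$ for some $r,s$; its finite elements form the set $\sqrt2\,\mathbb{Q}$. Writing $p/q\in\mathbb{Q}(\mathbf{H}_4)$ always means the normalized form: $(p,q)$ is the first column of a matrix in $\mathbf{H}_4$ with $q>0$. Explicitly, either $p=a$, $q=\sqrt2\,c$ with $a,c\in\mathbb{Z}$, $c>0$, $\gcd(a,2c)=1$, or $p=\sqrt2\,a$, $q=c$ with $a,c\in\mathbb{Z}$, $c>0$, $\gcd(2a,c)=1$. $p/q\in\mathbb{Q}(\mathbf{H}_4)$ is an $\mathbf{H}_4$-best approximation of a real number $\alpha$ if for any $r/s\in\mathbb{Q}(\mathbf{H}_4)$ with $r/s\ne p/q$ and $0<s\le q$ one has $|s\alpha-r|>|q\alpha-p|$. Distinct best approximations have distinct denominators. For a real number $\alpha$,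 $K(\alpha)$ is the infimum of those $K>0$ such that for all sufficiently large real $N$ there is $p/q\in\mathbb{Q}(\mathbf{H}_4)$ with $|q\alpha-p|<\frac{K}{N}$ and $1\le q\le N$. *)

theory Defs
  imports "HOL-Analysis.Analysis" "HOL-Algebra.Coset" "HOL-Algebra.Generated_Groups"
begin

definition SL2R :: "(real^2^2) monoid" where
  "SL2R = \<lparr>carrier = {A. det A = 1}, mult = (**), one = mat 1\<rparr>"

definition PSL2R :: "(real^2^2) set monoid" where
  "PSL2R = SL2R Mod {mat 1, - mat 1}"

definition psl_class :: "real^2^2 \<Rightarrow> (real^2^2) set" where
  "psl_class A = {mat 1, - mat 1} #>\<^bsub>SL2R\<^esub> A"

definition mat22 :: "real \<Rightarrow> real \<Rightarrow> real \<Rightarrow> real \<Rightarrow> real^2^2" where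
  "mat22 a b c d = vector [vector [a, b], vector [c, d]]"

definition hecke4 :: "(real^2^2) set set" where
  "hecke4 = generate PSL2R {psl_class (mat22 1 (sqrt 2) 0 1), psl_class (mat22 0 (-1) 1 0)}"

text \<open>A matrix is said to lie in the Hecke group when its class modulo sign does; so
  \<open>A\<close> lies in it iff \<open>- A\<close> does.\<close>

definition in_hecke4 :: "real^2^2 \<Rightarrow> bool" where
  "in_hecke4 A \<longleftrightarrow> A \<in> carrier SL2R \<and> psl_class A \<in> hecke4"

text \<open>The subset of the projective line; the value \<open>\<infinity>\<close> of type \<open>ereal\<close> stands for the single
  point at infinity (\<open>-\<infinity>\<close> is not used).\<close>

definition QH4 :: "ereal set" where
  "QH4 = {x. \<exists>p q r s. in_hecke4 (mat22 p r q s) \<and> x = (if q = 0 then \<infinity> else ereal (p / q))}"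

text \<open>\<open>QH4_frac p q\<close>: the fraction \<open>p/q\<close> is a finite element of \<open>QH4\<close> written in normalized form.\<close>

definition QH4_frac :: "real \<Rightarrow> real \<Rightarrow> bool" where
  "QH4_frac p q \<longleftrightarrow> q > 0 \<and> (\<exists>r s. in_hecke4 (mat22 p r q s))"

definition H4_best_approx :: "real \<Rightarrow> real \<Rightarrow> real \<Rightarrow> bool" where
  "H4_best_approx \<alpha> p q \<longleftrightarrow> QH4_frac p q \<and>
     (\<forall>r s. QH4_frac r s \<and> r / s \<noteq> p / q \<and> 0 < s \<and> s \<le> q \<longrightarrow> \<bar>s * \<alpha> - r\<bar> > \<bar>q * \<alpha> - p\<bar>)"

text \<open>The infimum is taken in the extended reals, so that it is \<open>\<infinity>\<close> if there is no admissible \<open>K\<close>.\<close>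

definition H4_K :: "real \<Rightarrow> ereal" where
  "H4_K \<alpha> = Inf {ereal K | K. K > 0 \<and>
     (\<forall>\<^sub>F N in at_top. \<exists>p q. QH4_frac p q \<and> \<bar>q * \<alpha> - p\<bar> < K / N \<and> 1 \<le> q \<and> q \<le> (N::real))}"

lemma group_SL2R: "group SL2R"
proof (rule groupI)
  fix A assume "A \<in> carrier SL2R"
  then have d: "det A = 1" by (simp add: SL2R_def)
  then have "invertible A" by (simp add: invertible_det_nz)
  then obtain B where B: "B ** A = mat 1" by (auto simp: invertible_def)
  then have "det B * det A = 1" by (metis det_mul det_I)
  with B d show "\<exists>B\<in>carrier SL2R. B \<otimes>\<^bsub>SL2R\<^esub> A = \<one>\<^bsub>SL2R\<^esub>"
    by (auto simp: SL2R_def)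
qed (auto simp: SL2R_def det_mul matrix_mul_assoc)

lemma uminus_matrix_mul: "(- A) ** B = - (A ** B)" "A ** (- B) = - (A ** B)"
  for A B :: "real^2^2"
  by (simp_all add: matrix_matrix_mult_def vec_eq_iff sum_negf)

lemma psl_class_eq: "psl_class A = {A, - A}"
  by (auto simp: psl_class_def r_coset_def SL2R_def uminus_matrix_mul)

lemma normal_pm: "{mat 1, - mat 1} \<lhd> SL2R"
proof -
  interpret group SL2R by (rule group_SL2R)
  have m: "det (- mat 1 :: real^2^2) = 1" by (simp add: det_2 mat_def)
  have i: "inv\<^bsub>SL2R\<^esub> (- mat 1) = - mat 1"
    by (rule inv_equality) (auto simp: SL2R_def m uminus_matrix_mul)
  have o: "\<one>\<^bsub>SL2R\<^esub> = mat 1" by (simp add: SL2R_def)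
  have "subgroup {mat 1, - mat 1} SL2R"
    by (rule subgroupI) (auto simp: i inv_one[unfolded o], auto simp: SL2R_def m uminus_matrix_mul)
  then show ?thesis
    by (rule normalI) (auto simp: r_coset_def l_coset_def SL2R_def uminus_matrix_mul)
qed

lemma group_PSL2R: "group PSL2R"
  unfolding PSL2R_def by (rule normal.factorgroup_is_group[OF normal_pm])

end

theory Submission
  imports Defs
begin

text \<open>Let \<open>e i = \<bar>q i * \<alpha> - p i\<bar>\<close>. Entries of Hecke matrices lie in the discrete set
  \<open>\<int> \<union> \<int>\<surd>2\<close>, so for each \<open>N\<close> the error \<open>\<bar>s * \<alpha> - r\<bar>\<close> attains its minimum over the normalized
  fractions \<open>r/s\<close> with \<open>s \<le> N\<close>. A minimizer of least denominator is a best approximation; the only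
  obstruction would be two fractions with the same denominator placed symmetrically around \<open>\<alpha>\<close>,
  which forces \<open>\<alpha> \<in> \<rat>\<surd>2\<close>, and for such \<open>\<alpha>\<close> the squared errors lie in a fixed multiple of
  \<open>\<nat>\<close> and cannot decrease forever. Hence for \<open>q (i - 1) \<le> N < q i\<close> the minimal error is
  \<open>e (i - 1)\<close>; the bound \<open>N < q i\<close> gives one inequality, and letting \<open>N\<close> tend to \<open>q i\<close> gives
  the other.\<close>

section \<open>The entries of Hecke matrices\<close>

definition Zsqrt2 :: "real set" where
  "Zsqrt2 = range (\<lambda>n::int. sqrt 2 * of_int n)"

lemma Zsqrt2I: "sqrt 2 * of_int n \<in> Zsqrt2"
  by (simp add: Zsqrt2_def)

lemma Zsqrt2_0: "0 \<in> Zsqrt2" and Zsqrt2_sqrt2: "sqrt 2 \<in> Zsqrt2"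
  using Zsqrt2I[of 0] Zsqrt2I[of 1] by simp_all

lemma Zsqrt2_minus: "- x \<in> Zsqrt2" if "x \<in> Zsqrt2"
proof -
  from that obtain n where "x = sqrt 2 * of_int n" by (auto simp: Zsqrt2_def)
  then show ?thesis using Zsqrt2I[of "- n"] by simp
qed

lemma Zsqrt2_add: "x + y \<in> Zsqrt2" if "x \<in> Zsqrt2" "y \<in> Zsqrt2"
proof -
  from that obtain m n where "x = sqrt 2 * of_int m" "y = sqrt 2 * of_int n"
    by (auto simp: Zsqrt2_def)
  then show ?thesis using Zsqrt2I[of "m + n"] by (simp add: algebra_simps)
qed

lemma Zsqrt2_diff: "x - y \<in> Zsqrt2" if "x \<in> Zsqrt2" "y \<in> Zsqrt2"
  using Zsqrt2_add[OF that(1) Zsqrt2_minus[OF that(2)]] by simp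

lemma Zsqrt2_mult_Ints: "x * y \<in> Zsqrt2" if "x \<in> Zsqrt2" "y \<in> \<int>"
proof -
  from that obtain m n where "x = sqrt 2 * of_int m" "y = of_int n"
    by (auto simp: Zsqrt2_def elim!: Ints_cases)
  then show ?thesis using Zsqrt2I[of "m * n"] by (simp add: algebra_simps)
qed

lemma Ints_mult_Zsqrt2: "x * y \<in> Zsqrt2" if "x \<in> \<int>" "y \<in> Zsqrt2"
  using Zsqrt2_mult_Ints[OF that(2,1)] by (simp add: mult.commute)

lemma Zsqrt2_mult: "x * y \<in> \<int>" if "x \<in> Zsqrt2" "y \<in> Zsqrt2"
proof -
  from that obtain m n where "x = sqrt 2 * of_int m" "y = sqrt 2 * of_int n"
    by (auto simp: Zsqrt2_def)
  then have "x * y = of_int (2 * m * n)" by simp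
  then show ?thesis by (metis Ints_of_int)
qed

lemmas Zsqrt2_intros =
  Zsqrt2_0 Zsqrt2_sqrt2 Zsqrt2_minus Zsqrt2_add Zsqrt2_diff Zsqrt2_mult_Ints Ints_mult_Zsqrt2 Zsqrt2_mult

lemma Ints_Zsqrt2_ge_1: "x \<ge> 1" if "x \<in> \<int> \<union> Zsqrt2" "x > 0"
  using that(1)
proof
  assume "x \<in> \<int>"
  then show ?thesis using that(2) by (auto elim!: Ints_cases)
next
  assume "x \<in> Zsqrt2"
  then obtain n where n: "x = sqrt 2 * of_int n" by (auto simp: Zsqrt2_def)
  then have "of_int n \<ge> (1::real)" using that(2) by (simp add: zero_less_mult_iff)
  then have "sqrt 2 * of_int n \<ge> 1 * (1::real)" by (intro mult_mono) auto
  then show ?thesis using n by simp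
qed

text \<open>Translation by sqrt 2 has the first entry pattern, the inversion
  \<open>mat22 0 (-1) 1 0\<close> the second.\<close>

definition hecke_form :: "real^2^2 \<Rightarrow> bool" where
  "hecke_form A \<longleftrightarrow> det A = 1 \<and>
     (A$1$1 \<in> \<int> \<and> A$2$2 \<in> \<int> \<and> A$1$2 \<in> Zsqrt2 \<and> A$2$1 \<in> Zsqrt2 \<or>
      A$1$1 \<in> Zsqrt2 \<and> A$2$2 \<in> Zsqrt2 \<and> A$1$2 \<in> \<int> \<and> A$2$1 \<in> \<int>)"

lemma mat22_nth [simp]:
  "mat22 a b c d $ 1 $ 1 = a" "mat22 a b c d $ 1 $ 2 = b"
  "mat22 a b c d $ 2 $ 1 = c" "mat22 a b c d $ 2 $ 2 = d"
  by (simp_all add: mat22_def)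

lemma hecke_form_uminus: "hecke_form (- A)" if "hecke_form A"
  using that by (auto simp: hecke_form_def det_2 intro: Zsqrt2_minus)

lemma hecke_form_one: "hecke_form (mat 1)"
  by (auto simp: hecke_form_def mat_def det_2 intro: Zsqrt2_intros)

text \<open>The ring generated by sqrt 2 is graded by the parity of the power of sqrt 2, and the two
  patterns multiply like these parities.\<close>

lemma hecke_form_mult: "hecke_form (A ** B)" if "hecke_form A" "hecke_form B"
proof -
  have "det (A ** B) = 1" using that by (simp add: hecke_form_def det_mul)
  moreover have nth: "(A ** B) $ i $ j = A$i$1 * B$1$j + A$i$2 * B$2$j" for i j
    by (simp add: matrix_matrix_mult_def sum_2)
  ultimately show ?thesis
    using that unfolding hecke_form_def nth
    by (elim conjE disjE) (simp_all add: Zsqrt2_intros)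
qed

lemma hecke_form_inverse:
  assumes "hecke_form A"
  obtains B where "hecke_form B" "B ** A = mat 1"
proof
  let ?B = "mat22 (A$2$2) (- (A$1$2)) (- (A$2$1)) (A$1$1)"
  show "hecke_form ?B"
    using assms by (auto simp: hecke_form_def det_2 Zsqrt2_minus algebra_simps)
  show "?B ** A = mat 1"
    using assms
    by (simp add: vec_eq_iff forall_2 matrix_matrix_mult_def sum_2 mat_def hecke_form_def det_2
        algebra_simps)
qed

section \<open>Passing to classes modulo sign\<close>

lemma PSL2R_mult: "psl_class A \<otimes>\<^bsub>PSL2R\<^esub> psl_class B = psl_class (A ** B)"
  by (auto simp: PSL2R_def FactGroup_def set_mult_def psl_class_eq SL2R_def uminus_matrix_mul
      matrix_mul_assoc matrix_matrix_mult_def vec_eq_iff sum_negf)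

lemma PSL2R_one: "\<one>\<^bsub>PSL2R\<^esub> = psl_class (mat 1)"
  by (simp add: PSL2R_def FactGroup_def psl_class_eq)

lemma psl_class_in_carrier: "psl_class A \<in> carrier PSL2R" if "hecke_form A"
  using that
  by (auto simp: PSL2R_def FactGroup_def RCOSETS_def psl_class_def SL2R_def hecke_form_def)

lemma hecke4_subset: "hecke4 \<subseteq> psl_class ` Collect hecke_form"
proof
  interpret P: group PSL2R by (rule group_PSL2R)
  fix X
  assume "X \<in> hecke4"
  then have "X \<in> generate PSL2R {psl_class (mat22 1 (sqrt 2) 0 1), psl_class (mat22 0 (-1) 1 0)}"
    by (simp add: hecke4_def)
  then show "X \<in> psl_class ` Collect hecke_form"
  proof induction
    case one
    then show ?case by (auto simp: PSL2R_one intro: hecke_form_one)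
  next
    case (incl h)
    then show ?case by (auto simp: hecke_form_def det_2 intro!: imageI Zsqrt2_intros)
  next
    case (inv h)
    then obtain A where A: "h = psl_class A" "hecke_form A"
      by (auto simp: hecke_form_def det_2 Zsqrt2_intros)
    obtain B where B: "hecke_form B" "B ** A = mat 1"
      using hecke_form_inverse[OF A(2)] .
    have "inv\<^bsub>PSL2R\<^esub> h = psl_class B"
      unfolding A(1) using A B
      by (intro P.inv_equality) (simp_all add: PSL2R_mult PSL2R_one psl_class_in_carrier)
    then show ?case using B(1) by auto
  next
    case (eng h1 h2)
    then show ?case by (auto simp: PSL2R_mult intro!: imageI hecke_form_mult)
  qed
qed

text \<open>A class determines its matrix up to sign, and the form is stable under sign
  change.\<close>

lemma in_hecke4_imp_hecke_form: "hecke_form A" if "in_hecke4 A"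
proof -
  from that have "psl_class A \<in> psl_class ` Collect hecke_form"
    using hecke4_subset by (auto simp: in_hecke4_def)
  then obtain B where "psl_class A = psl_class B" "hecke_form B" by auto
  then have "A = B \<or> A = - B" by (auto simp: psl_class_eq doubleton_eq_iff)
  then show ?thesis using \<open>hecke_form B\<close> hecke_form_uminus by auto
qed

section \<open>Normalized fractions\<close>

text \<open>The second column is kept because \<open>p * s - r * q = 1\<close> does the work of
  coprimality.\<close>

lemma QH4_frac_imp:
  assumes "QH4_frac p q"
  obtains r s where "p * s - r * q = 1" "q > 0"
    "p \<in> \<int> \<and> s \<in> \<int> \<and> r \<in> Zsqrt2 \<and> q \<in> Zsqrt2 \<or> p \<in> Zsqrt2 \<and> s \<in> Zsqrt2 \<and> r \<in> \<int> \<and> q \<in> \<int>"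
  using assms in_hecke4_imp_hecke_form
  by (force simp: QH4_frac_def hecke_form_def det_2)

lemma QH4_frac_cases:
  assumes "QH4_frac p q"
  obtains (odd) a c :: int where "p = of_int a" "q = sqrt 2 * of_int c"
    | (even) a c :: int where "p = sqrt 2 * of_int a" "q = of_int c"
proof -
  obtain r s where "p \<in> \<int> \<and> s \<in> \<int> \<and> r \<in> Zsqrt2 \<and> q \<in> Zsqrt2 \<or>
      p \<in> Zsqrt2 \<and> s \<in> Zsqrt2 \<and> r \<in> \<int> \<and> q \<in> \<int>"
    using QH4_frac_imp[OF assms] .
  then show ?thesis
    using odd even unfolding Zsqrt2_def by (blast elim!: Ints_cases)
qed

lemma QH4_frac_ge_1: "QH4_frac p q \<Longrightarrow> q \<ge> 1"
  by (rule QH4_frac_imp) (auto intro: Ints_Zsqrt2_ge_1)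

text \<open>If \<open>(p', q') = l * (p, q)\<close> then \<open>inverse l = p * s' - q * r'\<close> lies in \<open>\<int> \<union> \<int>\<surd>2\<close>, so \<open>l \<le> 1\<close>.\<close>

lemma QH4_frac_same_value_le:
  assumes "QH4_frac p q" "QH4_frac p' q'" "p / q = p' / q'"
  shows "q' \<le> q"
proof -
  obtain r s where 1: "q > 0"
    "p \<in> \<int> \<and> s \<in> \<int> \<and> r \<in> Zsqrt2 \<and> q \<in> Zsqrt2 \<or> p \<in> Zsqrt2 \<and> s \<in> Zsqrt2 \<and> r \<in> \<int> \<and> q \<in> \<int>"
    using QH4_frac_imp[OF assms(1)] .
  obtain r' s' where 2: "p' * s' - r' * q' = 1" "q' > 0"
    "p' \<in> \<int> \<and> s' \<in> \<int> \<and> r' \<in> Zsqrt2 \<and> q' \<in> Zsqrt2 \<or> p' \<in> Zsqrt2 \<and> s' \<in> Zsqrt2 \<and> r' \<in> \<int> \<and> q' \<in> \<int>"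
    using QH4_frac_imp[OF assms(2)] .
  have p: "p = p' * (q / q')" using 1 2 assms(3) by (simp add: field_simps)
  \<comment> \<open>Columns of the same pattern give an integer, columns of different patterns an
    integer multiple of sqrt 2.\<close>
  have "p * s' - r' * q \<in> \<int> \<union> Zsqrt2"
    using 1(2) 2(3) by (elim disjE conjE) (blast intro: Zsqrt2_intros Ints_mult Ints_diff)+
  moreover have "p * s' - r' * q = (p' * s' - r' * q') * (q / q')"
    using 2(2) unfolding p by (simp add: field_simps)
  ultimately have "q / q' \<in> \<int> \<union> Zsqrt2" using 2(1) by simp
  then have "q / q' \<ge> 1" using 1(1) 2(2) by (intro Ints_Zsqrt2_ge_1) auto
  then show ?thesis using 2(2) by (simp add: field_simps)
qed

section \<open>Discreteness of normalized fractions\<close>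

lemma abs_le_sqrt2_mult: "\<bar>x\<bar> \<le> \<bar>sqrt 2 * x\<bar>" for x :: real
  using mult_right_mono[of 1 "sqrt 2" "\<bar>x\<bar>"] by (simp add: abs_mult)

text \<open>Bounds on denominator and error bound the numerator, so both integer coordinates lie in
  a finite box.\<close>

lemma finite_QH4_frac: "finite {(r, s). QH4_frac r s \<and> s \<le> N \<and> \<bar>s * \<alpha> - r\<bar> \<le> C}"
proof -
  \<comment> \<open>A common bound for the numerator, at most
    \<open>N * \<bar>\<alpha>\<bar> + C\<close>, and the denominator, at most
    \<open>N\<close>.\<close>
  define B where "B = \<lceil>N * \<bar>\<alpha>\<bar> + C + N\<rceil>"
  have B: "\<bar>n\<bar> \<le> B" if "\<bar>real_of_int n\<bar> \<le> N * \<bar>\<alpha>\<bar> + C + N" for n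
  proof -
    have "real_of_int \<bar>n\<bar> \<le> of_int B"
      unfolding B_def using that le_of_int_ceiling order.trans by fastforce
    then show ?thesis by (simp only: of_int_le_iff)
  qed
  let ?I = "{-B..B} \<times> {-B..B}"
  have "{(r, s). QH4_frac r s \<and> s \<le> N \<and> \<bar>s * \<alpha> - r\<bar> \<le> C} \<subseteq>
      (\<lambda>(a, c). (of_int a, sqrt 2 * of_int c)) ` ?I \<union> (\<lambda>(a, c). (sqrt 2 * of_int a, of_int c)) ` ?I"
  proof clarify
    fix r s
    assume rs: "QH4_frac r s" "s \<le> N" "\<bar>s * \<alpha> - r\<bar> \<le> C"
      "(r, s) \<notin> (\<lambda>(a, c). (sqrt 2 * of_int a, of_int c)) ` ?I"
    have s: "s \<ge> 1" using rs(1) by (rule QH4_frac_ge_1)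
    have "\<bar>s * \<alpha>\<bar> \<le> N * \<bar>\<alpha>\<bar>"
      using rs(2) s by (simp add: abs_mult mult_right_mono)
    then have r: "\<bar>r\<bar> \<le> N * \<bar>\<alpha>\<bar> + C + N" and s': "\<bar>s\<bar> \<le> N * \<bar>\<alpha>\<bar> + C + N"
      using rs(2,3) s by linarith+
    from rs(1) show "(r, s) \<in> (\<lambda>(a, c). (of_int a, sqrt 2 * of_int c)) ` ?I"
    proof (cases rule: QH4_frac_cases)
      case (odd a c)
      have "\<bar>a\<bar> \<le> B" "\<bar>c\<bar> \<le> B"
        using r s' odd abs_le_sqrt2_mult[of "of_int c"] by (auto intro!: B)
      then show ?thesis using odd by (auto intro!: image_eqI[of _ _ "(a, c)"])
    next
      case (even a c)
      have "\<bar>a\<bar> \<le> B" "\<bar>c\<bar> \<le> B"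
        using r s' even abs_le_sqrt2_mult[of "of_int a"] by (auto intro!: B)
      then show ?thesis using rs(4) even by (auto intro!: image_eqI[of _ _ "(a, c)"])
    qed
  qed
  then show ?thesis by (rule finite_subset) auto
qed

text \<open>With \<open>\<alpha> = \<surd>2 * u / v\<close>, the errors have the form \<open>n / v\<close> or \<open>\<surd>2 * n / v\<close>.\<close>

lemma QH4_frac_square_error:
  fixes u v :: int and \<alpha> :: real
  assumes "QH4_frac r s" "v > 0" "\<alpha> = sqrt 2 * u / v"
  obtains k :: nat where "(v * \<bar>s * \<alpha> - r\<bar>)\<^sup>2 = real k"
  using assms(1)
proof (cases rule: QH4_frac_cases)
  case (odd a c)
  have "v * (s * \<alpha> - r) = of_int (2 * c * u - a * v)"
    using odd assms(2) unfolding assms(3) by (simp add: field_simps)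
  then have "(v * (s * \<alpha> - r))\<^sup>2 = (of_int (2 * c * u - a * v))\<^sup>2"
    by (simp only:)
  then have "(v * \<bar>s * \<alpha> - r\<bar>)\<^sup>2 = real (nat ((2 * c * u - a * v)\<^sup>2))"
    by (simp add: power_mult_distrib)
  then show ?thesis by (rule that)
next
  case (even a c)
  have "v * (s * \<alpha> - r) = sqrt 2 * of_int (c * u - a * v)"
    using even assms(2) unfolding assms(3) by (simp add: field_simps)
  then have "(v * (s * \<alpha> - r))\<^sup>2 = 2 * (of_int (c * u - a * v))\<^sup>2"
    by (simp only: power_mult_distrib) simp
  then have "(v * \<bar>s * \<alpha> - r\<bar>)\<^sup>2 = real (nat (2 * (c * u - a * v)\<^sup>2))"
    by (simp add: power_mult_distrib)
  then show ?thesis by (rule that)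
qed

text \<open>After squaring, 2 has odd exponent on the left and even exponent on the right. Hence a
  denominator cannot be of both types.\<close>

lemma sqrt2_mult_int_neq:
  fixes m n :: int
  assumes "m \<noteq> 0"
  shows "sqrt 2 * m \<noteq> n"
proof
  assume "sqrt 2 * m = n"
  then have "real_of_int (2 * m\<^sup>2) = real_of_int (n\<^sup>2)"
    by (metis of_int_mult of_int_numeral of_int_power power_mult_distrib real_sqrt_pow2 zero_le_numeral)
  then have eq: "2 * m\<^sup>2 = n\<^sup>2" by (simp only: of_int_eq_iff)
  then have "n \<noteq> 0" using assms by auto
  then have "multiplicity 2 (2 * m\<^sup>2) = Suc (2 * multiplicity 2 m)"
    "multiplicity 2 (n\<^sup>2) = 2 * multiplicity 2 n"
    using assms by (simp_all add: prime_elem_multiplicity_mult_distrib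
        prime_elem_multiplicity_power_distrib)
  then have "Suc (2 * multiplicity 2 m) = 2 * multiplicity 2 n" using eq by simp
  then show False by presburger
qed

text \<open>The common denominator forces both fractions to be of the same type, so the midpoint
  keeps a single factor sqrt 2, above or below the bar.\<close>

lemma QH4_frac_symmetric_imp_Rats:
  assumes "QH4_frac r s" "QH4_frac r' s" "\<alpha> = (r + r') / (2 * s)"
  shows "\<alpha> / sqrt 2 \<in> \<rat>"
proof -
  have s: "s > 0" using assms(1) by (simp add: QH4_frac_def)
  from assms(1) show ?thesis
  proof (cases rule: QH4_frac_cases)
    case o: (odd a c)
    from assms(2) show ?thesis
    proof (cases rule: QH4_frac_cases)
      case (odd a' c')
      have "\<alpha> / sqrt 2 = (of_int a + of_int a') / (4 * of_int c)"
        using o odd(1) assms(3) by (simp add: field_simps)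
      then show ?thesis by simp
    next
      case (even a' c')
      then show ?thesis using sqrt2_mult_int_neq[of c c'] o s by (cases "c = 0") auto
    qed
  next
    case e: (even a c)
    from assms(2) show ?thesis
    proof (cases rule: QH4_frac_cases)
      case (odd a' c')
      then show ?thesis using sqrt2_mult_int_neq[of c' c] e s by (cases "c' = 0") auto
    next
      case (even a' c')
      have "\<alpha> = sqrt 2 * (of_int a + of_int a') / (2 * of_int c)"
        using e even(1) assms(3) by (simp add: algebra_simps)
      then have "\<alpha> / sqrt 2 = (of_int a + of_int a') / (2 * of_int c)" by simp
      then show ?thesis by simp
    qed
  qed
qed

section \<open>The sequence of best approximations\<close>

text \<open>Indexing starts at 1; \<open>p 0\<close> and \<open>q 0\<close> are arbitrary, whence
  the guards \<open>i \<ge> 1\<close> below.\<close>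

locale H4_best_seq =
  fixes \<alpha> :: real and p q :: "nat \<Rightarrow> real"
  assumes q_less_Suc: "\<And>i. i \<ge> 1 \<Longrightarrow> q i < q (i + 1)"
    and best_eq: "{(p i, q i) | i. i \<ge> 1} = {(a, b). H4_best_approx \<alpha> a b}"
begin

definition e :: "nat \<Rightarrow> real" where "e i = \<bar>q i * \<alpha> - p i\<bar>"

lemma best: "i \<ge> 1 \<Longrightarrow> H4_best_approx \<alpha> (p i) (q i)"
  using best_eq by blast

lemma best_obtain:
  assumes "H4_best_approx \<alpha> a b"
  obtains i where "i \<ge> 1" "a = p i" "b = q i"
  using assms best_eq by blast

lemma frac: "i \<ge> 1 \<Longrightarrow> QH4_frac (p i) (q i)"
  using best by (simp add: H4_best_approx_def)

lemma q_ge_1: "i \<ge> 1 \<Longrightarrow> q i \<ge> 1"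
  using frac QH4_frac_ge_1 by blast

lemma q_strict_mono: "i < j \<Longrightarrow> i \<ge> 1 \<Longrightarrow> q i < q j"
proof (induction rule: less_Suc_induct)
  case (1 i)
  then show ?case using q_less_Suc[of i] by simp
next
  case (2 i j k)
  then show ?case by fastforce
qed

text \<open>The earlier fraction competes with the later best approximation. Its value is different,
  since equal values would force equal denominators.\<close>

lemma e_strict_antimono:
  assumes "i < j" "i \<ge> 1"
  shows "e j < e i"
proof -
  have q: "q i < q j" using assms by (rule q_strict_mono)
  then have "p i / q i \<noteq> p j / q j"
    using QH4_frac_same_value_le[OF frac[of i] frac[of j]] assms by auto
  then show ?thesis
    using best[of j] frac[of i] q q_ge_1[of i] assms by (auto simp: H4_best_approx_def e_def)
qed

text \<open>Infinite descent on the squared errors scaled by \<open>v\<close>, which are natural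
  numbers. This later rules out ties.\<close>

lemma alpha_not_Rats: "\<alpha> / sqrt 2 \<notin> \<rat>"
proof
  assume "\<alpha> / sqrt 2 \<in> \<rat>"
  then obtain u v :: int where uv: "v > 0" "\<alpha> / sqrt 2 = of_int u / of_int v"
    by (metis Rats_cases')
  then have \<alpha>: "\<alpha> = sqrt 2 * u / v" by (simp add: field_simps)
  have "\<exists>k. (v * e (Suc i))\<^sup>2 = real k" for i
    using QH4_frac_square_error[OF frac[of "Suc i"] uv(1) \<alpha>] unfolding e_def by auto
  then obtain k where k: "\<And>i. (v * e (Suc i))\<^sup>2 = real (k i)" by metis
  have "k (Suc i) < k i" for i
  proof -
    have "v * e (Suc (Suc i)) < v * e (Suc i)"
      using e_strict_antimono[of "Suc i" "Suc (Suc i)"] uv(1) by simp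
    then have "(v * e (Suc (Suc i)))\<^sup>2 < (v * e (Suc i))\<^sup>2"
      using uv(1) by (intro power_strict_mono) (auto simp: e_def)
    then show ?thesis unfolding k by simp
  qed
  then show False using wf_no_infinite_down_chainE[OF wf_less_than, of k] by auto
qed

text \<open>Errors never exceed \<open>e 1\<close>, so bounded denominators would leave only
  finitely many pairs for infinitely many indices.\<close>

lemma exists_q_gt: "\<exists>i\<ge>1. N < q i"
proof (rule ccontr)
  assume neg: "\<not> ?thesis"
  have "(p i, q i) \<in> {(r, s). QH4_frac r s \<and> s \<le> N \<and> \<bar>s * \<alpha> - r\<bar> \<le> e 1}" if "i \<in> {1..}" for i
    using that neg frac[of i] e_strict_antimono[of 1 i] by (cases "i = 1") (auto simp: e_def)
  then have "finite ((\<lambda>i. (p i, q i)) ` {1..})"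
    by (intro finite_subset[OF _ finite_QH4_frac[of N \<alpha> "e 1"]]) blast
  moreover have "inj_on (\<lambda>i. (p i, q i)) {1..}"
    by (rule inj_onI) (metis Pair_inject atLeast_iff less_irrefl linorder_neqE_nat q_strict_mono)
  ultimately have "finite {1::nat..}" by (rule finite_imageD)
  then show False using infinite_Ici by blast
qed

lemma q_bracket:
  assumes "q 1 \<le> N"
  obtains i where "i \<ge> 1" "q i \<le> N" "N < q (Suc i)"
proof -
  define j where "j = (LEAST i. i \<ge> 1 \<and> N < q i)"
  have j: "j \<ge> 1 \<and> N < q j"
    unfolding j_def using exists_q_gt[of N] LeastI_ex[of "\<lambda>i. i \<ge> 1 \<and> N < q i"] by blast
  then have "j \<noteq> 1" using assms by auto
  then have "j - 1 \<ge> 1" using j by linarith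
  moreover have "q (j - 1) \<le> N"
    using not_less_Least[of "j - 1" "\<lambda>i. i \<ge> 1 \<and> N < q i"] calculation j
    unfolding j_def[symmetric] by fastforce
  moreover have "N < q (Suc (j - 1))" using j by simp
  ultimately show ?thesis by (rule that)
qed

text \<open>The least error up to denominator \<open>s\<close> is attained by a best approximation;
  its index is at most \<open>i\<close>, and errors decrease with the index.\<close>

lemma e_le:
  assumes "i \<ge> 1" "QH4_frac r s" "s < q (Suc i)"
  shows "e i \<le> \<bar>s * \<alpha> - r\<bar>"
proof -
  define err where "err = (\<lambda>(r, s). \<bar>s * \<alpha> - r\<bar>)"
  \<comment> \<open>Discarding errors larger than that of \<open>r/s\<close> makes the set finite
    without changing the minimum.\<close>
  define S where "S = {(r', s'). QH4_frac r' s' \<and> s' \<le> s \<and> \<bar>s' * \<alpha> - r'\<bar> \<le> \<bar>s * \<alpha> - r\<bar>}"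
  have fin: "finite S" unfolding S_def by (rule finite_QH4_frac)
  have ne: "S \<noteq> {}" using assms(2) by (auto simp: S_def)
  define T where "T = {x \<in> S. \<forall>y \<in> S. err x \<le> err y}"
  have "T \<noteq> {}"
    using ex_is_arg_min_if_finite[OF fin ne, of err]
    unfolding T_def is_arg_min_linorder by blast
  moreover have "finite T" using fin by (simp add: T_def)
  ultimately obtain x where x: "x \<in> T" "\<And>y. y \<in> T \<Longrightarrow> snd x \<le> snd y"
    using ex_is_arg_min_if_finite[of T snd] unfolding is_arg_min_linorder by blast
  obtain a b where ab: "x = (a, b)" by fastforce
  have abS: "QH4_frac a b" "b \<le> s" "\<bar>b * \<alpha> - a\<bar> \<le> \<bar>s * \<alpha> - r\<bar>"
    using x(1) by (auto simp: T_def S_def ab)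
  have min: "\<bar>b * \<alpha> - a\<bar> \<le> \<bar>b' * \<alpha> - a'\<bar>" if "QH4_frac a' b'" "b' \<le> s" for a' b'
  proof (cases "(a', b') \<in> S")
    case True
    then show ?thesis using x(1) by (force simp: T_def err_def ab)
  next
    case False
    then show ?thesis using that abS(3) by (auto simp: S_def)
  qed
  have "H4_best_approx \<alpha> a b"
    unfolding H4_best_approx_def
  proof (intro conjI allI impI)
    show "QH4_frac a b" by fact
    fix a' b'
    assume *: "QH4_frac a' b' \<and> a' / b' \<noteq> a / b \<and> 0 < b' \<and> b' \<le> b"
    then have le: "\<bar>b * \<alpha> - a\<bar> \<le> \<bar>b' * \<alpha> - a'\<bar>" using abS by (intro min) auto
    show "\<bar>b * \<alpha> - a\<bar> < \<bar>b' * \<alpha> - a'\<bar>"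
    proof (rule ccontr)
      assume "\<not> ?thesis"
      with le have eq: "\<bar>b * \<alpha> - a\<bar> = \<bar>b' * \<alpha> - a'\<bar>" by simp
      then have "(a', b') \<in> T"
        using * abS x(1) by (auto simp: T_def S_def err_def ab)
      then have "b' = b" using x(2)[of "(a', b')"] * by (simp add: ab)
      \<comment> \<open>The values differ but the denominators agree, so equal errors put \<alpha>
        at the midpoint.\<close>
      then have "\<alpha> = (a + a') / (2 * b)"
        using eq * by (auto simp: abs_eq_iff field_simps)
      then have "\<alpha> / sqrt 2 \<in> \<rat>"
        using QH4_frac_symmetric_imp_Rats abS(1) * \<open>b' = b\<close> by blast
      then show False using alpha_not_Rats by simp
    qed
  qed
  then obtain j where j: "j \<ge> 1" "a = p j" "b = q j" by (rule best_obtain)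
  then have "q j < q (Suc i)" using abS(2) assms(3) by simp
  then have "\<not> Suc i \<le> j" using q_strict_mono[of "Suc i" j] by (cases "Suc i = j") auto
  then have "e i \<le> e j" using e_strict_antimono[of j i] j by (cases "i = j") auto
  then show ?thesis using abS(3) j by (simp add: e_def)
qed

section \<open>Admissible constants against the limsup\<close>

definition admissible :: "real \<Rightarrow> bool" where
  "admissible K \<longleftrightarrow> K > 0 \<and>
     (\<forall>\<^sub>F N in at_top. \<exists>p q. QH4_frac p q \<and> \<bar>q * \<alpha> - p\<bar> < K / N \<and> 1 \<le> q \<and> q \<le> (N::real))"

abbreviation L :: ereal where
  "L \<equiv> limsup (\<lambda>i. ereal (q i * e (i - 1)))"

lemma eventually_q_ge: "\<forall>\<^sub>F i in sequentially. N \<le> q i"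
proof -
  obtain j where "j \<ge> 1" "N < q j" using exists_q_gt by blast
  then show ?thesis
    unfolding eventually_sequentially
    by (intro exI[of _ j]) (metis le_less less_le_trans q_strict_mono)
qed

text \<open>For \<open>N\<close> just below \<open>q (Suc i)\<close> every fraction allowed has
  error at least \<open>e i\<close>, so \<open>N * e i \<le> K\<close>; then \<open>N\<close> tends
  to \<open>q (Suc i)\<close>.\<close>

lemma limsup_le_if_admissible:
  assumes "admissible K"
  shows "L \<le> ereal K"
proof -
  from assms obtain N\<^sub>0 where N0: "\<And>N. N \<ge> N\<^sub>0 \<Longrightarrow>
      \<exists>p q. QH4_frac p q \<and> \<bar>q * \<alpha> - p\<bar> < K / N \<and> 1 \<le> q \<and> q \<le> N"
    by (auto simp: admissible_def eventually_at_top_linorder)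
  have *: "q (Suc i) * e i \<le> K" if i: "i \<ge> 1" "N\<^sub>0 \<le> q i" for i
  proof -
    have "N * e i \<le> K" if N: "q i < N" "N < q (Suc i)" for N
    proof -
      obtain r s where rs: "QH4_frac r s" "\<bar>s * \<alpha> - r\<bar> < K / N" "s \<le> N"
        using N0[of N] N i by auto
      then have "e i < K / N" using e_le[OF i(1) rs(1)] N by linarith
      then show ?thesis using N q_ge_1[OF i(1)] by (simp add: field_simps)
    qed
    \<comment> \<open>Isolating \<open>N\<close> allows passing to the endpoint by density;
      \<open>e i\<close> is positive because it exceeds \<open>e (Suc i)\<close>.\<close>
    then have "N \<le> K / e i" if "q i < N" "N < q (Suc i)" for N
      using that e_strict_antimono[of i "Suc i"] i(1)
      by (simp add: pos_le_divide_eq e_def)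
    then have "q (Suc i) \<le> K / e i"
      using q_less_Suc[OF i(1)] dense_le_bounded[of "q i" "q (Suc i)" "K / e i"] by simp
    then show ?thesis
      using e_strict_antimono[of i "Suc i"] i(1) by (simp add: pos_le_divide_eq e_def)
  qed
  have "\<forall>\<^sub>F i in sequentially. i \<ge> 1 \<and> N\<^sub>0 \<le> q i"
    using eventually_q_ge eventually_ge_at_top by (rule eventually_conj[rotated])
  then have "\<forall>\<^sub>F i in sequentially. ereal (q (Suc i) * e (Suc i - 1)) \<le> ereal K"
    by eventually_elim (use * in auto)
  then have "\<forall>\<^sub>F i in sequentially. ereal (q i * e (i - 1)) \<le> ereal K"
    by (rule eventually_sequentially_Suc[THEN iffD1])
  then show ?thesis by (rule Limsup_bounded)
qed

text \<open>Supplies the positivity demanded of an admissible constant.\<close>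

lemma limsup_nonneg: "0 \<le> L"
proof (rule le_Limsup)
  show "\<forall>\<^sub>F i in sequentially. 0 \<le> ereal (q i * e (i - 1))"
    using eventually_q_ge[of 0] by eventually_elim (simp add: e_def)
qed simp

text \<open>For \<open>N\<close> between \<open>q i\<close> and \<open>q (Suc i)\<close> the witness
  is \<open>p i / q i\<close>, since \<open>N * e i \<le> q (Suc i) * e i < K\<close>.\<close>

lemma admissible_if_limsup_less:
  assumes "L < ereal K"
  shows "admissible K"
proof -
  have K: "K > 0" using le_less_trans[OF limsup_nonneg assms] by simp
  have "\<forall>\<^sub>F i in sequentially. ereal (q i * e (i - 1)) < ereal K"
    using assms by (rule Limsup_lessD)
  then obtain m where m: "\<And>i. i \<ge> m \<Longrightarrow> q i * e (i - 1) < K"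
    by (auto simp: eventually_sequentially)
  \<comment> \<open>The bound \<open>q 1\<close> makes bracketing possible; \<open>q (Suc m)\<close>
    pushes the bracketing index into the range governed by \<open>m\<close>.\<close>
  have "\<forall>\<^sub>F N in at_top. max (q 1) (q (Suc m)) \<le> N" by (rule eventually_ge_at_top)
  then have "\<forall>\<^sub>F N in at_top. \<exists>p q. QH4_frac p q \<and> \<bar>q * \<alpha> - p\<bar> < K / N \<and> 1 \<le> q \<and> q \<le> N"
  proof eventually_elim
    case (elim N)
    then obtain i where i: "i \<ge> 1" "q i \<le> N" "N < q (Suc i)" using q_bracket[of N] by auto
    have "Suc i \<ge> m"
    proof (rule ccontr)
      assume "\<not> ?thesis"
      then have "q (Suc i) < q (Suc m)" by (intro q_strict_mono) auto
      then show False using elim i(3) by simp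
    qed
    then have "q (Suc i) * e i < K" using m[of "Suc i"] by simp
    moreover have "N * e i \<le> q (Suc i) * e i"
      using i(3) by (intro mult_right_mono) (auto simp: e_def)
    moreover have "N > 0" using q_ge_1[OF i(1)] i(2) by simp
    ultimately have "e i < K / N" by (simp add: field_simps)
    then show ?case using frac i q_ge_1[OF i(1)] unfolding e_def by blast
  qed
  then show ?thesis using K by (simp add: admissible_def)
qed

lemma H4_K_eq_limsup: "H4_K \<alpha> = L"
proof -
  have K: "H4_K \<alpha> = Inf {ereal K | K. admissible K}"
    by (simp add: H4_K_def admissible_def)
  show ?thesis
  proof (rule antisym)
    show "H4_K \<alpha> \<le> L"
    proof (rule ccontr)
      assume "\<not> ?thesis"
      \<comment> \<open>A finite value strictly in between exists even if the infimum is infinite;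
        it would be admissible yet below the infimum.\<close>
      then obtain x where x: "L < ereal x" "ereal x < H4_K \<alpha>"
        using ereal_dense2[of L "H4_K \<alpha>"] by (meson not_le)
      have "H4_K \<alpha> \<le> ereal x"
        unfolding K using admissible_if_limsup_less[OF x(1)] by (auto intro!: Inf_lower)
      then show False using x(2) by simp
    qed
    show "L \<le> H4_K \<alpha>"
      unfolding K using limsup_le_if_admissible by (auto intro!: Inf_greatest)
  qed
qed

end

theorem lemma4p4:
  fixes \<alpha> :: real and p q :: "nat \<Rightarrow> real"
  assumes "ereal \<alpha> \<notin> QH4"
    and "\<And>i. i \<ge> 1 \<Longrightarrow> q i < q (i + 1)"
    and "{(p i, q i) | i. i \<ge> 1} = {(a, b). H4_best_approx \<alpha> a b}"
  shows "H4_K \<alpha> = limsup (\<lambda>i. ereal (q i * \<bar>q (i - 1) * \<alpha> - p (i - 1)\<bar>))"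
proof -
  interpret H4_best_seq \<alpha> p q using assms(2,3) by unfold_locales
  show ?thesis using H4_K_eq_limsup by (simp add: e_def)
qed

end
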